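(* Let $n\ge 1$, let $p=p_1p_2\cdots p_n$ be a permutation of $\{1,2,\dots,n\}$, and let $b(p)$ be the number of bad pairs of $p$. Then $p$ can be sorted by at most $b(p)/2$ block moves. In particular, every permutation of $\{1,2,\dots,n\}$ can be sorted by at most $\lfloor (n+1)/2\rfloor$ block moves.
   Context: Permutations of $\{1,\dots,n\}$ are written in one-line notation $p=p_1p_2\cdots p_n$. A block of $p$ is a (nonempty) string of consecutive entries $p_ip_{i+1}\cdots p_j$. A block move is the operation that interchanges two disjoint blocks of $p$, which may or may not be adjacent, without changing the order of the entries within each block and leaving all other entries in the same relative order: writing $p$ as a concatenation $p=A\,X\,B\,Y\,C$ with $X,Y$ nonempty strings and $A,B,C$ possibly empty strings, the block move interchanging $X$ and $Y$ produces the permutation $A\,Y\,B\,X\,C$. A sequence of block moves sorts $p$ if applying the moves successively takes $p$ to the increasing permutation $12\cdots n$. For $0\le i\le n$, the pair of indices $(i,i+1)$ is a good pair in $p$ if any of the following holds: (1) $1\le i\le n-1$ and $p_{i+1}=p_i+1$; (2) $i=0$ and $p_1=1$; (3) $i=n$ and $p_n=n$. A bad pair is any pair $(j,j+1)$ with $0\le j\le n$ that is not a good pair. *)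

theory Defs
  imports Complex_Main "HOL-Combinatorics.Multiset_Permutations"
begin

text \<open>A permutation of \<open>{1..n}\<close> in one-line notation is a list in
  \<^term>\<open>permutations_of_set {1..n}\<close>.\<close>

definition block_move :: "nat list \<Rightarrow> nat list \<Rightarrow> bool" where
  "block_move p q \<longleftrightarrow>
     (\<exists>A X B Y C. X \<noteq> [] \<and> Y \<noteq> [] \<and> p = A @ X @ B @ Y @ C \<and> q = A @ Y @ B @ X @ C)"

definition sorted_by_block_moves :: "nat \<Rightarrow> nat list \<Rightarrow> bool" where
  "sorted_by_block_moves k p \<longleftrightarrow> (block_move ^^ k) p [1..<Suc (length p)]"

text \<open>The pair \<open>(i, i + 1)\<close> is represented by its first index \<open>i\<close>. Positions are counted from 1,
  so the entry at position \<open>i\<close> is \<open>p ! (i - 1)\<close>.\<close>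

definition good_pair :: "nat list \<Rightarrow> nat \<Rightarrow> bool" where
  "good_pair p i \<longleftrightarrow>
     (1 \<le> i \<and> i \<le> length p - 1 \<and> p ! i = p ! (i - 1) + 1) \<or>
     (i = 0 \<and> p ! 0 = 1) \<or>
     (i = length p \<and> p ! (length p - 1) = length p)"

definition num_bad_pairs :: "nat list \<Rightarrow> nat" where
  "num_bad_pairs p = card {j. j \<le> length p \<and> \<not> good_pair p j}"

end

theory Submission
  imports Defs
begin

text \<open>Frame the permutation \<open>p\<close> by \<open>0\<close> on the left and \<open>n + 1\<close> on the right. The bad pairs of
  \<open>p\<close> are then exactly the breaks of the framed list, that is, the neighbours \<open>x, y\<close> with
  \<open>y \<noteq> x + 1\<close>; the two boundary clauses in the definition of a good pair disappear.

  It suffices that an unsorted \<open>p\<close> always admits a block move that destroys two bad pairs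
  (\<open>ex_block_move_removing_two_bad_pairs\<close>): the bound then follows by induction on their number.
  Let \<open>0, 1, \<dots>, k\<close> be the longest correctly placed initial segment of the framed list. The entry
  \<open>k + 1\<close> stands further right, and the stretch between \<open>k\<close> and \<open>k + 1\<close> is nonempty. Let \<open>m\<close> be
  the largest entry of that stretch. Then \<open>m > k + 1\<close>, and \<open>m + 1\<close> lies neither in the initial
  segment nor in the stretch, so it stands to the right of \<open>k + 1\<close> (it may be the frame entry
  \<open>n + 1\<close>). The framed list therefore looks like
  \<open>0 \<dots> k | \<dots> m | \<dots> | (k + 1) \<dots> | (m + 1) \<dots> (n + 1)\<close>, where the third part may be empty.
  Interchanging the second and the fourth part puts \<open>k + 1\<close> after \<open>k\<close> and \<open>m + 1\<close> after \<open>m\<close>, which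
  gives two new good pairs. No good pair is lost: each junction that is cut has \<open>k\<close> or \<open>m\<close> on its
  left or \<open>k + 1\<close> or \<open>m + 1\<close> on its right, without the matching partner on the other side
  (\<open>breaks_swap\<close>).\<close>

section \<open>Breaks of a list\<close>

fun breaks :: "nat list \<Rightarrow> nat" where
  "breaks (x # y # zs) = (if y = Suc x then 0 else 1) + breaks (y # zs)"
| "breaks _ = 0"

lemma breaks_append:
  assumes "xs \<noteq> []" "ys \<noteq> []"
  shows "breaks (xs @ ys) = breaks xs + (if hd ys = Suc (last xs) then 0 else 1) + breaks ys"
  using assms
proof (induction xs rule: breaks.induct)
  case ("2_2" v)
  then show ?case by (cases ys) auto
qed auto

lemma breaks_eq_card: "breaks l = card {i. Suc i < length l \<and> l ! Suc i \<noteq> Suc (l ! i)}"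
proof (induction l rule: breaks.induct)
  case (1 x y zs)
  let ?S = "\<lambda>l. {i. Suc i < length l \<and> l ! Suc i \<noteq> Suc (l ! i)}"
  have "?S (x # y # zs) = (if y = Suc x then {} else {0}) \<union> Suc ` ?S (y # zs)" (is "_ = ?A \<union> ?B")
  proof (rule set_eqI)
    fix i show "i \<in> ?S (x # y # zs) \<longleftrightarrow> i \<in> ?A \<union> ?B"
      by (cases i) auto
  qed
  moreover have "finite (?S (y # zs))"
    by (rule finite_subset[of _ "{..<length (y # zs)}"]) auto
  then have "card (?A \<union> ?B) = card ?A + card ?B"
    by (intro card_Un_disjoint finite_imageI) auto
  moreover have "card ?B = card (?S (y # zs))"
    by (rule card_image) simp
  moreover have "card ?A = (if y = Suc x then 0 else 1)"
    by simp
  ultimately show ?case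
    by (simp only: breaks.simps 1)
qed auto

text \<open>The frame must consist of \<open>0\<close> and \<open>length p + 1\<close> so that neighbours \<open>0, 1\<close> and \<open>n, n + 1\<close>
  at the two ends reproduce the boundary clauses of \<^const>\<open>good_pair\<close>.\<close>

lemma num_bad_pairs_eq_breaks:
  assumes "p \<noteq> []"
  shows "num_bad_pairs p = breaks (0 # p @ [Suc (length p)])"
proof -
  let ?l = "0 # p @ [Suc (length p)]"
  have "good_pair p j \<longleftrightarrow> ?l ! Suc j = Suc (?l ! j)" if "j \<le> length p" for j
  proof (cases "j = length p")
    case True
    then show ?thesis
      using assms by (cases p rule: rev_cases) (auto simp: good_pair_def nth_append)
  next
    case False
    then show ?thesis
      using assms that by (cases j) (auto simp: good_pair_def nth_append)
  qed
  then have "{j. j \<le> length p \<and> \<not> good_pair p j} =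
             {i. Suc i < length ?l \<and> ?l ! Suc i \<noteq> Suc (?l ! i)}"
    by (auto simp: less_Suc_eq_le)
  then show ?thesis
    unfolding num_bad_pairs_def breaks_eq_card by simp
qed

section \<open>A block move that removes two breaks\<close>

text \<open>The interchange makes the junctions of \<open>L\<close> with \<open>Y\<close> and of \<open>X\<close> with \<open>D\<close> good. None of the
  old junctions was good: by distinctness, the successor of \<open>last L\<close> occurs only at the front of
  \<open>Y\<close>, and that of \<open>last X\<close> only at the front of \<open>D\<close>, whereas each old junction involves a member
  of one of these two pairs without its partner. The case of adjacent blocks has one junction less
  and is counted separately.\<close>

lemma breaks_swap:
  assumes dist: "distinct (L @ X @ B @ Y @ D)"
    and ne: "L \<noteq> []" "X \<noteq> []" "Y \<noteq> []" "D \<noteq> []"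
    and LY: "hd Y = Suc (last L)" and XD: "hd D = Suc (last X)"
  shows "breaks (L @ Y @ B @ X @ D) + 2 \<le> breaks (L @ X @ B @ Y @ D)"
proof -
  have mem: "last L \<in> set L" "last X \<in> set X" "hd X \<in> set X" "hd Y \<in> set Y" "last Y \<in> set Y"
    "hd D \<in> set D"
    using ne by auto
  have LX: "hd X \<noteq> Suc (last L)" and YD: "hd D \<noteq> Suc (last Y)"
    using dist mem LY XD by (auto dest: sym)
  show ?thesis
  proof (cases "B = []")
    case True
    have "hd Y \<noteq> Suc (last X)"
      using dist mem XD by (auto dest: sym)
    then show ?thesis
      using ne LX YD LY XD True by (simp add: breaks_append)
  next
    case False
    then have B: "hd B \<in> set B" "last B \<in> set B" by auto
    have "hd B \<noteq> Suc (last X)" "hd Y \<noteq> Suc (last B)"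
      using dist mem B LY XD by (auto dest: sym)
    then show ?thesis
      using ne False LX YD LY XD by (simp add: breaks_append)
  qed
qed

lemma block_move_perm:
  assumes "block_move p q"
  shows "length q = length p" "set q = set p" "distinct q \<longleftrightarrow> distinct p"
  using assms unfolding block_move_def by auto

text \<open>The two entries that are brought together with their predecessors are \<open>k + 1\<close>, the first one
  missing from the sorted initial segment, and \<open>m + 1\<close>, for the largest \<open>m\<close> in front of \<open>k + 1\<close>
  outside that segment. Maximality of \<open>m\<close> is what puts \<open>m + 1\<close> to the right of \<open>k + 1\<close>, so that
  a single interchange serves both.\<close>

lemma ex_block_move_removing_two_bad_pairs:
  assumes set_p: "set p = {1..n}" and dist_p: "distinct p" and unsorted: "p \<noteq> [1..<Suc n]"
  shows "\<exists>q. block_move p q \<and> num_bad_pairs q + 2 \<le> num_bad_pairs p"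
proof -
  have len_p: "length p = n"
    using distinct_card[OF dist_p] set_p by simp
  have p_ne: "p \<noteq> []"
    using len_p unsorted by auto
  obtain A P S where pA: "p = A @ P" and idA: "[1..<Suc n] = A @ S"
    and "P = [] \<or> S = [] \<or> hd P \<noteq> hd S"
    using longest_common_prefix by blast
  moreover have "length P = length S"
    using arg_cong[OF pA, of length] arg_cong[OF idA, of length] len_p
    by (simp del: upt_Suc)
  moreover have "P \<noteq> S"
    using pA idA unsorted by auto
  ultimately have P_ne: "P \<noteq> []" and hdP: "hd P \<noteq> hd S" and S_ne: "S \<noteq> []" by auto
  define k where "k = length A"
  have k_lt: "k < n"
    using pA P_ne len_p k_def by auto
  have A_eq: "A = [1..<Suc k]" and S_eq: "S = [Suc k..<Suc n]"
  proof -
    have "A = take k [1..<Suc n]" "S = drop k [1..<Suc n]"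
      unfolding idA by (simp_all add: k_def)
    then show "A = [1..<Suc k]" "S = [Suc k..<Suc n]"
      using k_lt by (simp_all add: take_upt drop_upt del: upt_Suc)
  qed
  have last_L: "last (0 # A) = k"
    by (cases k) (simp_all add: A_eq)
  have "hd S = Suc k"
    using k_lt by (simp add: S_eq upt_conv_Cons del: upt_Suc)
  have set_P: "set P = {Suc k..n}"
  proof -
    have "set p = set A \<union> set P" "set A \<inter> set P = {}"
      using pA dist_p by auto
    then have "set P = {1..n} - set A"
      using set_p by blast
    also have "\<dots> = {Suc k..n}"
      unfolding A_eq by auto
    finally show ?thesis .
  qed
  then have "Suc k \<in> set P"
    using k_lt by auto
  then obtain M R where P_eq: "P = M @ Suc k # R"
    by (meson split_list)
  have M_ne: "M \<noteq> []"
    using P_eq hdP \<open>hd S = Suc k\<close> by auto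
  define m where "m = Max (set M)"
  have mM: "m \<in> set M" and m_max: "\<And>x. x \<in> set M \<Longrightarrow> x \<le> m"
    using M_ne by (auto simp: m_def)
  then obtain X' B where M_eq: "M = X' @ m # B"
    by (meson split_list)
  have m_bounds: "Suc k < m" "m \<le> n"
  proof -
    have "m \<in> {Suc k..n}"
      using mM set_P P_eq by auto
    moreover have "m \<noteq> Suc k"
      using mM pA P_eq dist_p by auto
    ultimately show "Suc k < m" "m \<le> n" by auto
  qed
  have "Suc m \<in> set (R @ [Suc n])"
  proof (cases "m = n")
    case False
    then have "Suc m \<in> set P"
      using m_bounds set_P by auto
    moreover have "Suc m \<notin> set M"
      using m_max by fastforce
    ultimately show ?thesis
      using P_eq m_bounds by auto
  qed simp
  then obtain Y' C' where R_eq: "R @ [Suc n] = Y' @ Suc m # C'"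
    by (meson split_list)
  define L X Y D C where "L = 0 # A" and "X = X' @ [m]" and "Y = Suc k # Y'"
    and "D = Suc m # C'" and "C = butlast D"
  note block_defs = L_def X_def Y_def D_def
  \<comment> \<open>\<open>D\<close> carries the right frame entry, so it is never empty, although \<open>C\<close> is empty if \<open>m = n\<close>.\<close>
  have "last D = Suc n"
    using arg_cong[OF R_eq, of last] unfolding D_def by simp
  then have D_eq: "D = C @ [Suc n]"
    unfolding C_def by (metis D_def append_butlast_last_id list.distinct(1))
  have R_YC: "R = Y' @ C"
    using R_eq D_eq unfolding D_def by (metis append_assoc append_same_eq)
  have p_eq: "p = A @ X @ B @ Y @ C"
    using pA P_eq M_eq R_YC by (simp add: block_defs)
  define q where "q = A @ Y @ B @ X @ C"
  have move: "block_move p q"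
    unfolding block_move_def p_eq q_def by (intro exI[of _ A] exI[of _ X] exI[of _ B]
        exI[of _ Y] exI[of _ C]) (simp add: X_def Y_def)
  have frame_p: "0 # p @ [Suc n] = L @ X @ B @ Y @ D"
    by (simp add: p_eq L_def D_eq)
  have frame_q: "0 # q @ [Suc n] = L @ Y @ B @ X @ D"
    by (simp add: q_def L_def D_eq)
  have "distinct (0 # p @ [Suc n])"
    using dist_p set_p by simp
  then have "breaks (L @ Y @ B @ X @ D) + 2 \<le> breaks (L @ X @ B @ Y @ D)"
    unfolding frame_p
    by (rule breaks_swap) (simp_all add: last_L[folded L_def], simp_all add: block_defs)
  moreover have "num_bad_pairs p = breaks (L @ X @ B @ Y @ D)"
    using num_bad_pairs_eq_breaks[OF p_ne] len_p frame_p by simp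
  moreover have "num_bad_pairs q = breaks (L @ Y @ B @ X @ D)"
    using num_bad_pairs_eq_breaks[of q] block_move_perm(1)[OF move] len_p p_ne frame_q
    by fastforce
  ultimately show ?thesis
    using move by auto
qed

section \<open>Sorting by block moves\<close>

lemma sorted_by_half_num_bad_pairs:
  assumes "set p = {1..n}" "distinct p"
  shows "\<exists>k. 2 * k \<le> num_bad_pairs p \<and> sorted_by_block_moves k p"
  using assms
proof (induction "num_bad_pairs p" arbitrary: p rule: less_induct)
  case less
  have len_p: "length p = n"
    using distinct_card[OF less.prems(2)] less.prems(1) by simp
  show ?case
  proof (cases "p = [1..<Suc n]")
    case True
    then have "sorted_by_block_moves 0 p"
      unfolding sorted_by_block_moves_def using len_p by simp
    then show ?thesis by (intro exI[of _ 0]) simp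
  next
    case False
    then obtain q where q: "block_move p q" "num_bad_pairs q + 2 \<le> num_bad_pairs p"
      using ex_block_move_removing_two_bad_pairs less.prems by blast
    note perm = block_move_perm[OF q(1)]
    obtain k where k: "2 * k \<le> num_bad_pairs q" "sorted_by_block_moves k q"
      using less.hyps[of q] q(2) perm less.prems by auto
    have "sorted_by_block_moves (Suc k) p"
      using relpowp_Suc_I2[of block_move, OF q(1)] k(2) perm(1)
      unfolding sorted_by_block_moves_def by metis
    then show ?thesis
      using k(1) q(2) by (intro exI[of _ "Suc k"]) simp
  qed
qed

lemma num_bad_pairs_le: "num_bad_pairs p \<le> length p + 1"
proof -
  have "num_bad_pairs p \<le> card {..length p}"
    unfolding num_bad_pairs_def by (rule card_mono) auto
  then show ?thesis by simp
qed

theorem theorem7: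
  fixes n :: nat
  assumes "n \<ge> 1"
  shows "(\<forall>p \<in> permutations_of_set {1..n}.
            \<exists>k. real k \<le> real (num_bad_pairs p) / 2 \<and> sorted_by_block_moves k p) \<and>
         (\<forall>p \<in> permutations_of_set {1..n}.
            \<exists>k. k \<le> (n + 1) div 2 \<and> sorted_by_block_moves k p)"
proof -
  have "\<exists>k. 2 * k \<le> num_bad_pairs p \<and> 2 * k \<le> n + 1 \<and> sorted_by_block_moves k p"
    if "p \<in> permutations_of_set {1..n}" for p
  proof -
    have p: "set p = {1..n}" "distinct p"
      using that by (auto simp: permutations_of_set_def)
    then have "length p = n"
      using distinct_card[OF p(2)] by simp
    then show ?thesis
      using sorted_by_half_num_bad_pairs[OF p] num_bad_pairs_le[of p] le_trans by fastforce
  qed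
  moreover have "real k \<le> real b / 2" if "2 * k \<le> b" for k b :: nat
    using that by linarith
  moreover have "k \<le> (n + 1) div 2" if "2 * k \<le> n + 1" for k
    using that by linarith
  ultimately show ?thesis by meson
qed

end
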